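(* Let $\mathcal{X},\mathcal{Y}$ be finite alphabets. For any joint distribution $P_{XY}$ on $\mathcal{X}\times\mathcal{Y}$ (with associated channel $P_{Y|X}$ from $\mathcal{X}$ to $\mathcal{Y}$), $$\lim_{\epsilon\to0}\ \lim_{n\to\infty}\frac1n\,\mathcal{L}^C_\epsilon(X^n\to Y^n)=C(P_{Y|X}),$$ where $(X^n,Y^n)$ is distributed i.i.d. according to $P_{XY}$ and $C(P_{Y|X})$ is the Shannon capacity of the channel $P_{Y|X}$.
   Context: Logarithms are in a common base (e.g. natural). Dashes denote Markov chains. For $\epsilon>0$, the recoverable leakage from $X$ to $Y$ is $$\mathcal{L}^C_\epsilon(X\to Y)=\sup_{\substack{(U,X):\,U-X-Y\\ \Pr(U=\hat U(Y))\ge1-\epsilon}}\log\frac{\Pr(U=\hat U(Y))}{\max_uP_U(u)},$$ where the supremum is over all joint laws of $(U,X)$ (so the law of $X$ on $\mathcal{X}$ is also optimized, while the channel $P_{Y|X}$ is fixed), $U$ has finite support of arbitrary size, and $\hat U(Y)$ is the maximum a posteriori estimator of $U$ from $Y$. Thus $\mathcal{L}^C_\epsilon(X\to Y)$ depends on $P_{XY}$ only through $P_{Y|X}$, and $\mathcal{L}^C_\epsilon(X^n\to Y^n)$ is the same quantity for the product channel $P_{Y^n|X^n}(y^n|x^n)=\prod_{i=1}^nP_{Y|X}(y_i|x_i)$, with the supremum over all joint laws of $(U,X^n)$. The capacity is $C(P_{Y|X})=\max_{P_X}I(X;Y)$. *)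

theory Defs
  imports "HOL-Probability.Probability"
begin

text \<open>
  A channel from \<open>'a\<close> to \<open>'b\<close> is a map \<open>W :: 'a \<Rightarrow> 'b pmf\<close>. For a joint law \<open>P\<close>, a conditional law
  is determined only where the first marginal is positive; any choice elsewhere is admitted.
\<close>

definition is_channel_of :: "('a \<times> 'b) pmf \<Rightarrow> ('a \<Rightarrow> 'b pmf) \<Rightarrow> bool" where
  "is_channel_of P W \<longleftrightarrow> (\<forall>x y. pmf P (x, y) = pmf (map_pmf fst P) x * pmf (W x) y)"

definition io_law :: "'x pmf \<Rightarrow> ('x \<Rightarrow> 'y pmf) \<Rightarrow> ('x \<times> 'y) pmf" where
  "io_law p W = bind_pmf p (\<lambda>x. map_pmf (\<lambda>y. (x, y)) (W x))"

text \<open>The supremum is a maximum, since mutual information is continuous on the compact simplex of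
  input laws.\<close>

definition capacity :: "real \<Rightarrow> ('x::finite \<Rightarrow> 'y::finite pmf) \<Rightarrow> real" where
  "capacity b W = (SUP p. prob_space.mutual_information (measure_pmf (io_law p W)) b
                            (count_space UNIV) (count_space UNIV) fst snd)"

text \<open>
  The memoryless extension. Words of length \<open>n\<close> are functions on \<open>{..<n}\<close>, extended by
  \<open>undefined\<close>; the inputs are the elements of \<open>words n\<close>.
\<close>

definition words :: "nat \<Rightarrow> (nat \<Rightarrow> 'x) set" where
  "words n = ({..<n} \<rightarrow>\<^sub>E UNIV)"

definition product_channel ::
  "nat \<Rightarrow> ('x \<Rightarrow> 'y pmf) \<Rightarrow> (nat \<Rightarrow> 'x) \<Rightarrow> (nat \<Rightarrow> 'y) pmf" where
  "product_channel n W xs = Pi_pmf {..<n} undefined (\<lambda>i. W (xs i))"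

text \<open>
  The law of \<open>(U, Y)\<close> when \<open>(U, X)\<close> has law \<open>Q\<close> and \<open>Y\<close> is drawn from \<open>W x\<close> given \<open>X = x\<close>,
  independently of \<open>U\<close>: the Markov chain \<open>U - X - Y\<close> with channel \<open>W\<close>.
\<close>

definition markov_law :: "('u \<times> 'a) pmf \<Rightarrow> ('a \<Rightarrow> 'b pmf) \<Rightarrow> ('u \<times> 'b) pmf" where
  "markov_law Q W = bind_pmf Q (\<lambda>(u, x). map_pmf (\<lambda>y. (u, y)) (W x))"

definition posterior :: "('u \<times> 'b) pmf \<Rightarrow> 'b \<Rightarrow> 'u \<Rightarrow> real" where
  "posterior J y u = pmf J (u, y) / pmf (map_pmf snd J) y"

text \<open>Ties (and all values at outcomes \<open>y\<close> of probability zero) are resolved arbitrarily; this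
  does not affect \<open>map_success\<close>.\<close>

definition map_estimator :: "('u \<times> 'b) pmf \<Rightarrow> 'b \<Rightarrow> 'u" where
  "map_estimator J y = arg_max_on (posterior J y) (set_pmf (map_pmf fst J))"

definition map_success :: "('u \<times> 'b) pmf \<Rightarrow> real" where
  "map_success J = measure_pmf.prob J {(u, y). u = map_estimator J y}"

text \<open>
  \<open>A\<close> is the input alphabet. Since \<open>U\<close> has finite support and only its law matters, its values
  may be taken in \<open>nat\<close>.
\<close>

definition leakage_laws :: "real \<Rightarrow> 'a set \<Rightarrow> ('a \<Rightarrow> 'b pmf) \<Rightarrow> (nat \<times> 'a) pmf set" where
  "leakage_laws \<epsilon> A W = {Q. finite (set_pmf (map_pmf fst Q)) \<and> set_pmf (map_pmf snd Q) \<subseteq> A \<and>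
                             map_success (markov_law Q W) \<ge> 1 - \<epsilon>}"

definition max_prob :: "'u pmf \<Rightarrow> real" where
  "max_prob p = Max (pmf p ` set_pmf p)"

definition recoverable_leakage :: "real \<Rightarrow> real \<Rightarrow> 'a set \<Rightarrow> ('a \<Rightarrow> 'b pmf) \<Rightarrow> real" where
  "recoverable_leakage b \<epsilon> A W =
     (SUP Q \<in> leakage_laws \<epsilon> A W.
        log b (map_success (markov_law Q W) / max_prob (map_pmf fst Q)))"

lemma pmf_product_channel:
  assumes "ys \<in> words n"
  shows "pmf (product_channel n W xs) ys = (\<Prod>i<n. pmf (W (xs i)) (ys i))"
  unfolding product_channel_def
  by (rule pmf_Pi') (use assms in \<open>auto simp: words_def PiE_def extensional_def\<close>)

lemma pmf_io_law: "pmf (io_law p W) (x, y) = pmf p x * pmf (W x) y"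
proof -
  have "pmf (map_pmf (\<lambda>y. (x', y)) (W x')) (x, y) = indicator {x} x' * pmf (W x) y" for x'
  proof (cases "x' = x")
    case True
    then show ?thesis
      using pmf_map_inj'[of "\<lambda>y. (x, y)" "W x" y] by (simp add: inj_on_def)
  next
    case False
    then have "(x, y) \<notin> set_pmf (map_pmf (\<lambda>y. (x', y)) (W x'))" by auto
    then have "pmf (map_pmf (\<lambda>y. (x', y)) (W x')) (x, y) = 0" by (simp only: set_pmf_iff not_not)
    then show ?thesis using False by simp
  qed
  then show ?thesis
    unfolding io_law_def pmf_bind by (simp add: measure_pmf_single)
qed

lemma mutual_information_io_law:
  fixes p :: "'x::finite pmf" and W :: "'x \<Rightarrow> 'y::finite pmf"
  assumes "1 < b"
  shows "prob_space.mutual_information (measure_pmf (io_law p W)) b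
           (count_space UNIV) (count_space UNIV) fst snd =
         (\<Sum>(x, y)\<in>UNIV. pmf p x * pmf (W x) y * log b (pmf (W x) y / pmf (bind_pmf p W) y))"
proof -
  let ?J = "io_law p W"
  interpret information_space "measure_pmf ?J" b
    by (intro information_space.intro information_space_axioms.intro assms
        measure_pmf.prob_space_axioms)
  have sd: "simple_distributed (measure_pmf ?J) f (\<lambda>z. pmf (map_pmf f ?J) z)"
    for f :: "'x \<times> 'y \<Rightarrow> 'z"
    by (rule prob_space.simple_distributedI[OF measure_pmf.prob_space_axioms])
      (auto simp: simple_function_def pmf_map vimage_def intro!: arg_cong2[where f = measure])
  have 1: "map_pmf fst ?J = p"
    by (simp add: io_law_def map_bind_pmf map_pmf_comp)
       (simp add: map_pmf_const bind_return_pmf')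
  have 2: "map_pmf snd ?J = bind_pmf p W"
    by (simp add: io_law_def map_bind_pmf map_pmf_comp)
  have "prob_space.mutual_information (measure_pmf ?J) b (count_space UNIV) (count_space UNIV) fst snd =
    (\<Sum>(x, y)\<in>UNIV. pmf ?J (x, y) * log b (pmf ?J (x, y) / (pmf p x * pmf (bind_pmf p W) y)))"
    using mutual_information_simple_distributed[OF sd sd sd, of fst snd]
    by (simp add: 1 2)
  also have "\<dots> = (\<Sum>(x, y)\<in>UNIV. pmf p x * pmf (W x) y * log b (pmf (W x) y / pmf (bind_pmf p W) y))"
    by (intro sum.cong) (auto simp: pmf_io_law)
  finally show ?thesis .
qed

text \<open>Hence the supremum in \<open>capacity\<close> is taken in \<open>real\<close> over a bounded set.\<close>

lemma mutual_information_bdd_above: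
  fixes W :: "'x::finite \<Rightarrow> 'y::finite pmf"
  assumes b: "1 < b"
  shows "bdd_above (range (\<lambda>p. prob_space.mutual_information (measure_pmf (io_law p W)) b
                                 (count_space UNIV) (count_space UNIV) fst snd))"
proof (rule bdd_aboveI2)
  fix p :: "'x pmf"
  have lnb: "0 < ln b" using b by simp
  have "pmf p x * pmf (W x) y * log b (pmf (W x) y / pmf (bind_pmf p W) y) \<le> 1 / ln b" for x y
  proof (cases "pmf p x * pmf (W x) y = 0")
    case False
    define r w q where "r = pmf p x" and "w = pmf (W x) y" and "q = pmf (bind_pmf p W) y"
    have r: "0 < r" and w: "0 < w" "w \<le> 1"
      using False by (auto simp: r_def w_def less_le pmf_le_1)
    have "r * w = pmf p x * pmf (W x) y" by (simp add: r_def w_def)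
    also have "\<dots> \<le> (\<Sum>x\<in>UNIV. pmf p x * pmf (W x) y)"
      by (rule member_le_sum) auto
    also have "\<dots> = q"
      unfolding q_def pmf_bind by (subst integral_measure_pmf[of UNIV]) auto
    finally have rq: "r * w \<le> q" .
    have q: "0 < q" using rq mult_pos_pos[OF r w(1)] by linarith
    have "ln (w / q) \<le> ln (1 / r)"
      using rq r w q by (subst ln_le_cancel_iff) (auto simp: field_simps)
    also have "\<dots> \<le> 1 / r" using ln_le_minus_one[of "1 / r"] r by simp
    finally have "r * w * ln (w / q) \<le> r * w * (1 / r)"
      using r w by (intro mult_left_mono) auto
    also have "\<dots> \<le> 1" using r w by simp
    finally have "r * w * ln (w / q) / ln b \<le> 1 / ln b" using lnb by (intro divide_right_mono) auto
    then show ?thesis by (simp add: log_def r_def w_def q_def)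
  qed (use lnb in auto)
  then have "(\<Sum>(x, y)\<in>UNIV. pmf p x * pmf (W x) y * log b (pmf (W x) y / pmf (bind_pmf p W) y))
    \<le> (\<Sum>(x, y)\<in>(UNIV::('x \<times> 'y) set). 1 / ln b)"
    by (intro sum_mono) auto
  then show "prob_space.mutual_information (measure_pmf (io_law p W)) b
      (count_space UNIV) (count_space UNIV) fst snd \<le> (\<Sum>(x, y)\<in>(UNIV::('x \<times> 'y) set). 1 / ln b)"
    unfolding mutual_information_io_law[OF b] .
qed
lemma fst_markov_law: "map_pmf fst (markov_law Q W) = map_pmf fst Q"
  unfolding markov_law_def map_bind_pmf case_prod_unfold map_pmf_comp fst_conv map_pmf_const
  by (rule map_pmf_def[symmetric])

lemma map_estimator_optimal:
  assumes fin: "finite (set_pmf (map_pmf fst J))"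
  shows "pmf J (u, y) \<le> pmf J (map_estimator J y, y)"
proof (cases "pmf J (u, y) = 0")
  case False
  let ?S = "set_pmf (map_pmf fst J)"
  have uy: "(u, y) \<in> set_pmf J" using False by (simp add: set_pmf_iff)
  have u: "u \<in> ?S" using uy by force
  have "y \<in> set_pmf (map_pmf snd J)" using uy by force
  then have pos: "0 < pmf (map_pmf snd J) y" by (rule pmf_positive)
  have "Max (posterior J y ` ?S) \<in> posterior J y ` ?S"
    using fin u by (intro Max_in) blast+
  then obtain m where m: "m \<in> ?S" "Max (posterior J y ` ?S) = posterior J y m" by blast
  have "posterior J y v \<le> posterior J y m" if "v \<in> ?S" for v
    unfolding m(2)[symmetric] using fin that by (intro Max_ge finite_imageI imageI)
  with m(1)
  have "is_arg_max (posterior J y) (\<lambda>v. v \<in> ?S) m"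
    by (auto simp: is_arg_max_linorder)
  then have "is_arg_max (posterior J y) (\<lambda>v. v \<in> ?S) (map_estimator J y)"
    unfolding map_estimator_def arg_max_on_def arg_max_def by (rule someI)
  then have "posterior J y u \<le> posterior J y (map_estimator J y)"
    using u by (auto simp: is_arg_max_linorder)
  then show ?thesis using pos by (simp add: posterior_def divide_le_cancel)
qed simp

lemma max_prob_ge:
  assumes "finite (set_pmf p)"
  shows "pmf p u \<le> max_prob p" and "0 < max_prob p"
proof -
  have ge: "pmf p v \<le> max_prob p" if "v \<in> set_pmf p" for v
    unfolding max_prob_def using assms that by (intro Max_ge) auto
  obtain w where w: "w \<in> set_pmf p" using set_pmf_not_empty[of p] by blast
  show pos: "0 < max_prob p" using pmf_positive[OF w] ge[OF w] by simp
  show "pmf p u \<le> max_prob p"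
    using ge[of u] pos by (cases "u \<in> set_pmf p") (auto simp: set_pmf_iff)
qed

lemma map_success_le:
  assumes fin: "finite (set_pmf (map_pmf fst J))" and B: "finite B" "snd ` set_pmf J \<subseteq> B"
  shows "map_success J \<le> card B * max_prob (map_pmf fst J)"
proof -
  let ?I = "(\<lambda>y. (map_estimator J y, y)) ` B"
  have "map_success J = measure_pmf.prob J ({(u, y). u = map_estimator J y} \<inter> set_pmf J)"
    unfolding map_success_def by (rule measure_Int_set_pmf[symmetric])
  also have "\<dots> \<le> measure_pmf.prob J ?I"
  proof (intro measure_pmf.finite_measure_mono subsetI)
    fix z assume "z \<in> {(u, y). u = map_estimator J y} \<inter> set_pmf J"
    then have "z = (map_estimator J (snd z), snd z)" and "snd z \<in> B" using B(2) by auto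
    then show "z \<in> ?I" by (rule image_eqI)
  qed simp
  also have "\<dots> = (\<Sum>y\<in>B. pmf J (map_estimator J y, y))"
    using B by (subst measure_measure_pmf_finite) (auto simp: sum.reindex inj_on_def)
  also have "\<dots> \<le> (\<Sum>y\<in>B. max_prob (map_pmf fst J))"
  proof (rule sum_mono)
    fix y
    let ?u = "map_estimator J y"
    have "pmf J (?u, y) = measure_pmf.prob J {(?u, y)}" by (simp add: measure_pmf_single)
    also have "\<dots> \<le> measure_pmf.prob J (fst -` {?u})"
      by (intro measure_pmf.finite_measure_mono) auto
    also have "\<dots> = pmf (map_pmf fst J) ?u" by (simp add: pmf_map)
    also have "\<dots> \<le> max_prob (map_pmf fst J)" by (rule max_prob_ge[OF fin])
    finally show "pmf J (?u, y) \<le> max_prob (map_pmf fst J)" .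
  qed
  finally show ?thesis by simp
qed

lemma max_prob_le_map_success:
  assumes fin: "finite (set_pmf (map_pmf fst J))" and B: "finite B" "snd ` set_pmf J \<subseteq> B"
  shows "max_prob (map_pmf fst J) \<le> map_success J"
proof -
  have "max_prob (map_pmf fst J) \<in> pmf (map_pmf fst J) ` set_pmf (map_pmf fst J)"
    unfolding max_prob_def using fin by (intro Max_in) (auto simp: set_pmf_not_empty)
  then obtain u where u: "max_prob (map_pmf fst J) = pmf (map_pmf fst J) u" by blast
  have "pmf (map_pmf fst J) u = measure_pmf.prob J (fst -` {u} \<inter> set_pmf J)"
    by (simp add: pmf_map measure_Int_set_pmf)
  also have "\<dots> \<le> measure_pmf.prob J ((\<lambda>y. (u, y)) ` B)"
  proof (intro measure_pmf.finite_measure_mono subsetI)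
    fix z assume "z \<in> fst -` {u} \<inter> set_pmf J"
    then have "z = (u, snd z)" and "snd z \<in> B" using B(2) by auto
    then show "z \<in> (\<lambda>y. (u, y)) ` B" by (rule image_eqI)
  qed simp
  also have "\<dots> = (\<Sum>y\<in>B. pmf J (u, y))"
    using B by (subst measure_measure_pmf_finite) (auto simp: sum.reindex inj_on_def)
  also have "\<dots> \<le> (\<Sum>y\<in>B. pmf J (map_estimator J y, y))"
    by (intro sum_mono map_estimator_optimal fin)
  also have "\<dots> = measure_pmf.prob J ((\<lambda>y. (map_estimator J y, y)) ` B)"
    using B by (subst measure_measure_pmf_finite) (auto simp: sum.reindex inj_on_def)
  also have "\<dots> \<le> map_success J"
    unfolding map_success_def by (intro measure_pmf.finite_measure_mono) auto
  finally show ?thesis by (simp add: u)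
qed

text \<open>The real-valued supremum in \<open>recoverable_leakage\<close> is over a nonempty set that is bounded
  above.\<close>

lemma leakage_bdd_above:
  assumes b: "1 < b" and B: "finite B" "\<And>x. x \<in> A \<Longrightarrow> set_pmf (W x) \<subseteq> B"
  shows "bdd_above ((\<lambda>Q. log b (map_success (markov_law Q W) / max_prob (map_pmf fst Q)))
                     ` leakage_laws \<epsilon> A W)"
proof (rule bdd_aboveI2)
  fix Q assume "Q \<in> leakage_laws \<epsilon> A W"
  then have fin: "finite (set_pmf (map_pmf fst Q))" and A: "set_pmf (map_pmf snd Q) \<subseteq> A"
    by (auto simp: leakage_laws_def)
  let ?J = "markov_law Q W"
  have fin': "finite (set_pmf (map_pmf fst ?J))" using fin by (simp only: fst_markov_law)
  have sub: "snd ` set_pmf ?J \<subseteq> B"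
    using A B(2) by (fastforce simp: markov_law_def)
  note le = map_success_le[OF fin' B(1) sub, unfolded fst_markov_law]
  note ge = max_prob_le_map_success[OF fin' B(1) sub, unfolded fst_markov_law]
  note pos = max_prob_ge(2)[OF fin]
  have "0 < map_success ?J" using ge pos by linarith
  moreover have "map_success ?J / max_prob (map_pmf fst Q) \<le> card B"
    using le pos by (simp add: divide_le_eq mult.commute)
  ultimately show "log b (map_success ?J / max_prob (map_pmf fst Q)) \<le> log b (card B)"
    using b pos by (intro log_mono) auto
qed

lemma leakage_laws_nonempty:
  assumes "0 \<le> \<epsilon>" "A \<noteq> {}"
  shows "leakage_laws \<epsilon> A W \<noteq> {}"
proof -
  obtain a where a: "a \<in> A" using assms by blast
  let ?Q = "return_pmf (0::nat, a)" let ?J = "markov_law ?Q W"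
  have J: "?J = map_pmf (\<lambda>y. (0, y)) (W a)" by (simp add: markov_law_def bind_return_pmf)
  have "map_estimator ?J y = 0" for y
    unfolding map_estimator_def J arg_max_on_def arg_max_def is_arg_max_def
    by (rule some_equality) (auto simp: map_pmf_comp)
  then have "map_success ?J = 1"
    by (simp add: map_success_def J measure_map_pmf)
  then have "?Q \<in> leakage_laws \<epsilon> A W" using a assms by (simp add: leakage_laws_def)
  then show ?thesis by blast
qed

end

theory Submission
  imports Defs "HOL-Real_Asymp.Real_Asymp"
begin

text \<open>
  The normalised leakage converges to the capacity \<open>C\<close> for every fixed \<open>0 < \<epsilon> < 1\<close>.

  Upper bound: let \<open>q\<close> be the output law of a capacity-achieving input, so that
  \<open>D(W x \<parallel> q) \<le> C\<close> for every input \<open>x\<close>. If \<open>Y\<close> had law \<open>q\<^sup>n\<close> independently of \<open>U\<close>, then \<open>U\<close>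
  could be guessed with probability at most \<open>max P\<^sub>U\<close>. Changing the measure to the channel costs a
  factor \<open>exp (n (C + \<delta>))\<close>, up to an event whose probability vanishes by Hoeffding's inequality.

  Lower bound: Feinstein's maximal code construction gives about \<open>exp (n (C - \<delta>))\<close> codewords with
  disjoint decoding sets and error at most \<open>\<epsilon>\<close>; take \<open>U\<close> uniform on the codewords.
\<close>

section \<open>Mixtures of laws and concentration for independent coordinates\<close>

lemma measure_bind_pmf_integral:
  "measure_pmf.prob (bind_pmf p f) S = measure_pmf.expectation p (\<lambda>x. measure_pmf.prob (f x) S)"
proof -
  have "emeasure (measure_pmf (bind_pmf p f)) S = (\<integral>\<^sup>+x. ennreal (measure_pmf.prob (f x) S) \<partial>p)"
    unfolding emeasure_bind_pmf by (simp add: measure_pmf.emeasure_eq_measure)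
  also have "\<dots> = ennreal (measure_pmf.expectation p (\<lambda>x. measure_pmf.prob (f x) S))"
    by (intro nn_integral_eq_integral measure_pmf.integrable_const_bound[where B = 1]) auto
  finally show ?thesis
    by (simp add: measure_pmf.emeasure_eq_measure)
qed

text \<open>Coordinates of \<open>Pi_pmf\<close> are independent, and values in
  \<open>[-K, K]\<close> have range \<open>2 * K\<close>, whence the constant in the exponent. Both
  \<open>p\<close> and \<open>f\<close> may vary with \<open>i\<close>, as they must for a fixed
  input word with differing letters.\<close>

lemma Pi_pmf_Hoeffding:
  fixes f :: "'i \<Rightarrow> 'a \<Rightarrow> real"
  assumes I: "finite I" "I \<noteq> {}" and K: "0 < K" "\<And>i a. i \<in> I \<Longrightarrow> \<bar>f i a\<bar> \<le> K" and "0 \<le> \<delta>"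
  shows "measure_pmf.prob (Pi_pmf I d p)
           {h. (\<Sum>i\<in>I. measure_pmf.expectation (p i) (f i)) + real (card I) * \<delta> \<le> (\<Sum>i\<in>I. f i (h i))}
         \<le> exp (- (real (card I) * \<delta>\<^sup>2 / (2 * K\<^sup>2)))" (is "measure_pmf.prob ?P ?S \<le> _")
proof -
  have E: "measure_pmf.expectation ?P (\<lambda>h. f i (h i)) = measure_pmf.expectation (p i) (f i)"
    if "i \<in> I" for i
  proof -
    have "measure_pmf.expectation ?P (\<lambda>h. f i (h i))
      = measure_pmf.expectation (map_pmf (\<lambda>h. h i) ?P) (f i)" by simp
    then show ?thesis using that I by (simp only: Pi_pmf_component[OF I(1)] if_True)
  qed
  interpret H: Hoeffding_ineq "measure_pmf ?P" I "\<lambda>i h. f i (h i)" "\<lambda>_. - K" "\<lambda>_. K"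
    "\<Sum>i\<in>I. measure_pmf.expectation ?P (\<lambda>h. f i (h i))"
  proof unfold_locales
    have "prob_space.indep_vars (measure_pmf ?P) (\<lambda>_. borel) (\<lambda>i. f i \<circ> (\<lambda>h. h i)) I"
      by (intro prob_space.indep_vars_compose[OF measure_pmf.prob_space_axioms
            indep_vars_Pi_pmf[OF I(1)]]) simp
    then show "prob_space.indep_vars (measure_pmf ?P) (\<lambda>_. borel) (\<lambda>i h. f i (h i)) I"
      by (simp add: o_def)
  qed (use I K in \<open>auto simp: abs_le_iff minus_le_iff\<close>)
  have pos: "(\<Sum>i\<in>I. (K - - K)\<^sup>2) > 0"
    using I K by (intro sum_pos) auto
  have "measure_pmf.prob ?P ?S \<le> exp (-2 * (real (card I) * \<delta>)\<^sup>2 / (\<Sum>i\<in>I. (K - - K)\<^sup>2))"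
    using H.Hoeffding_ineq_ge[OF _ pos, of "real (card I) * \<delta>"] \<open>0 \<le> \<delta>\<close> by (simp add: E)
  also have "-2 * (real (card I) * \<delta>)\<^sup>2 / (\<Sum>i\<in>I. (K - - K)\<^sup>2) = - (real (card I) * \<delta>\<^sup>2 / (2 * K\<^sup>2))"
    using I K by (simp add: power2_eq_square field_simps)
  finally show ?thesis .
qed

section \<open>One-shot bounds on the recoverable leakage\<close>

text \<open>Optimality of the MAP rule: it maximises the joint mass separately for each
  \<open>y\<close>, so no decoder \<open>d\<close> beats it.\<close>

lemma map_success_ge:
  assumes fin: "finite (set_pmf (map_pmf fst J))" and B: "finite B" "snd ` set_pmf J \<subseteq> B"
  shows "measure_pmf.prob J {(u, y). u = d y} \<le> map_success J"
proof -
  have "measure_pmf.prob J {(u, y). u = d y} = measure_pmf.prob J ({(u, y). u = d y} \<inter> set_pmf J)"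
    by (simp add: measure_Int_set_pmf)
  also have "\<dots> \<le> measure_pmf.prob J ((\<lambda>y. (d y, y)) ` B)"
    using B(2) by (intro measure_pmf.finite_measure_mono) (auto simp: image_iff)
  also have "\<dots> = (\<Sum>y\<in>B. pmf J (d y, y))"
    using B by (subst measure_measure_pmf_finite) (auto simp: sum.reindex inj_on_def)
  also have "\<dots> \<le> (\<Sum>y\<in>B. pmf J (map_estimator J y, y))"
    by (intro sum_mono map_estimator_optimal fin)
  also have "\<dots> = measure_pmf.prob J ((\<lambda>y. (map_estimator J y, y)) ` B)"
    using B by (subst measure_measure_pmf_finite) (auto simp: sum.reindex inj_on_def)
  also have "\<dots> \<le> map_success J"
    unfolding map_success_def by (intro measure_pmf.finite_measure_mono) auto
  finally show ?thesis .
qed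

text \<open>Change of measure: outside the event that the likelihood ratio of \<open>w\<close> to
  \<open>r\<close> exceeds \<open>T\<close>, \<open>w\<close> is pointwise at most \<open>T\<close>
  times \<open>r\<close>.\<close>

lemma measure_pmf_le_sum_bad:
  assumes B: "finite B" "set_pmf w \<subseteq> B" and "0 \<le> T"
  shows "measure_pmf.prob w E \<le> measure_pmf.prob w {y. T * pmf r y < pmf w y} + T * measure_pmf.prob r E"
proof -
  let ?G = "{y. T * pmf r y < pmf w y}"
  have "measure_pmf.prob w E = measure_pmf.prob w (E \<inter> set_pmf w)"
    by (simp add: measure_Int_set_pmf)
  also have "\<dots> \<le> measure_pmf.prob w (?G \<union> (E \<inter> B - ?G))"
    using B by (intro measure_pmf.finite_measure_mono) auto
  also have "\<dots> \<le> measure_pmf.prob w ?G + measure_pmf.prob w (E \<inter> B - ?G)"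
    by (intro measure_Un_le) auto
  also have "measure_pmf.prob w (E \<inter> B - ?G) = (\<Sum>y\<in>E \<inter> B - ?G. pmf w y)"
    using B by (intro measure_measure_pmf_finite) auto
  also have "\<dots> \<le> (\<Sum>y\<in>E \<inter> B - ?G. T * pmf r y)"
    by (intro sum_mono) auto
  also have "\<dots> = T * measure_pmf.prob r (E \<inter> B - ?G)"
    using B by (subst measure_measure_pmf_finite) (auto simp: sum_distrib_left)
  also have "\<dots> \<le> T * measure_pmf.prob r E"
    using \<open>0 \<le> T\<close> by (intro mult_left_mono measure_pmf.finite_measure_mono) auto
  finally show ?thesis by simp
qed

lemma snd_markov_law_subset:
  assumes "set_pmf (map_pmf snd Q) \<subseteq> A" "\<And>x. x \<in> A \<Longrightarrow> set_pmf (W x) \<subseteq> B"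
  shows "snd ` set_pmf (markov_law Q W) \<subseteq> B"
  using assms by (fastforce simp: markov_law_def)

lemma markov_law_prob_guess:
  "measure_pmf.prob (markov_law Q W) {(u, y). u = d y}
     = measure_pmf.expectation Q (\<lambda>(u, x). measure_pmf.prob (W x) {y. u = d y})"
  unfolding markov_law_def measure_bind_pmf_integral
  by (intro Bochner_Integration.integral_cong) (auto simp: vimage_def)

text \<open>A meta-converse: against the auxiliary output law \<open>r\<close>, where \<open>Y\<close> is independent of \<open>U\<close>,
  no guess of \<open>U\<close> succeeds with probability above \<open>max_prob\<close>.\<close>

lemma map_success_converse:
  assumes fin: "finite (set_pmf (map_pmf fst Q))" and A: "set_pmf (map_pmf snd Q) \<subseteq> A"
    and B: "finite B" "\<And>x. x \<in> A \<Longrightarrow> set_pmf (W x) \<subseteq> B" and T: "0 \<le> T"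
    and bad: "\<And>x. x \<in> A \<Longrightarrow> measure_pmf.prob (W x) {y. T * pmf r y < pmf (W x) y} \<le> \<eta>"
  shows "map_success (markov_law Q W) \<le> \<eta> + T * max_prob (map_pmf fst Q)"
proof -
  define d where "d = map_estimator (markov_law Q W)"
  have int: "integrable (measure_pmf Q) (\<lambda>(u, x). measure_pmf.prob (g x) {y. u = d y})" for g :: "_ \<Rightarrow> _ pmf"
    by (intro measure_pmf.integrable_const_bound[where B = 1]) (auto split: prod.split)
  have "map_success (markov_law Q W)
      = measure_pmf.expectation Q (\<lambda>(u, x). measure_pmf.prob (W x) {y. u = d y})"
    unfolding map_success_def d_def[symmetric] by (rule markov_law_prob_guess)
  also have "\<dots> \<le> measure_pmf.expectation Q (\<lambda>z. \<eta> + T * (case z of (u, x) \<Rightarrow> measure_pmf.prob r {y. u = d y}))"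
  proof (intro integral_mono_AE int Bochner_Integration.integrable_add integrable_mult_right)
    show "AE z in Q. (case z of (u, x) \<Rightarrow> measure_pmf.prob (W x) {y. u = d y})
        \<le> \<eta> + T * (case z of (u, x) \<Rightarrow> measure_pmf.prob r {y. u = d y})"
    proof (rule AE_pmfI, clarify)
      fix u x assume "(u, x) \<in> set_pmf Q"
      then have x: "x \<in> A" using A by force
      show "measure_pmf.prob (W x) {y. u = d y} \<le> \<eta> + T * measure_pmf.prob r {y. u = d y}"
        using measure_pmf_le_sum_bad[OF B(1) B(2)[OF x] T, of "{y. u = d y}" r] bad[OF x] by linarith
    qed
  qed auto
  also have "\<dots> = \<eta> + T * measure_pmf.expectation Q (\<lambda>(u, x). measure_pmf.prob r {y. u = d y})"
    using int[of "\<lambda>_. r"] by simp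
  also have "measure_pmf.expectation Q (\<lambda>(u, x). measure_pmf.prob r {y. u = d y})
      = measure_pmf.expectation (map_pmf fst Q) (\<lambda>u. measure_pmf.prob r {y. u = d y})"
    by (simp add: case_prod_unfold)
  \<comment> \<open>This is the success probability of \<open>d\<close> when \<open>U\<close> and
    \<open>Y\<close> are independent. Drawing \<open>Y\<close> first and then \<open>U\<close>, the
    guess \<open>d y\<close> is right with probability \<open>pmf (map_pmf fst Q) (d y)\<close>,
    which \<open>max_prob\<close> bounds.\<close>
  also have "\<dots> = measure_pmf.prob (bind_pmf (map_pmf fst Q) (\<lambda>u. map_pmf (Pair u) r)) {(u, y). u = d y}"
    by (simp add: measure_bind_pmf_integral vimage_def del: integral_map_pmf)
  also have "bind_pmf (map_pmf fst Q) (\<lambda>u. map_pmf (Pair u) r)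
      = bind_pmf r (\<lambda>y. map_pmf (\<lambda>u. (u, y)) (map_pmf fst Q))"
    unfolding map_pmf_def[of "Pair _"] map_pmf_def[of "\<lambda>u. (u, _)"] by (rule bind_commute_pmf)
  also have "measure_pmf.prob \<dots> {(u, y). u = d y}
      = measure_pmf.expectation r (\<lambda>y. pmf (map_pmf fst Q) (d y))"
    unfolding measure_bind_pmf_integral measure_map_pmf
    by (simp add: vimage_def measure_pmf_single pmf_map)
  also have "\<dots> \<le> max_prob (map_pmf fst Q)"
    by (intro measure_pmf.integral_le_const measure_pmf.integrable_const_bound[where B = 1] AE_I2
          max_prob_ge fin) (auto simp: pmf_le_1)
  finally show ?thesis using T by (simp add: mult_left_mono)
qed

text \<open>Write \<open>s\<close> for the success probability and \<open>m\<close> for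
  \<open>max_prob\<close>. The converse gives s \<le> (1 - \<epsilon>)/2 + T m, and 1 - \<epsilon>
  \<le> s bounds the first term by s/2; so s \<le> 2 T m.\<close>

lemma leakage_le:
  assumes b: "1 < b" and \<epsilon>: "0 \<le> \<epsilon>" "A \<noteq> {}"
    and B: "finite B" "\<And>x. x \<in> A \<Longrightarrow> set_pmf (W x) \<subseteq> B" and T: "0 < T"
    and bad: "\<And>x. x \<in> A \<Longrightarrow> measure_pmf.prob (W x) {y. T * pmf r y < pmf (W x) y} \<le> (1 - \<epsilon>) / 2"
  shows "recoverable_leakage b \<epsilon> A W \<le> log b (2 * T)"
  unfolding recoverable_leakage_def
proof (rule cSUP_least)
  show "leakage_laws \<epsilon> A W \<noteq> {}" using \<epsilon> by (rule leakage_laws_nonempty)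
  fix Q assume Q: "Q \<in> leakage_laws \<epsilon> A W"
  then have fin: "finite (set_pmf (map_pmf fst Q))" and A: "set_pmf (map_pmf snd Q) \<subseteq> A"
    and s: "1 - \<epsilon> \<le> map_success (markov_law Q W)"
    by (auto simp: leakage_laws_def)
  let ?J = "markov_law Q W"
  have fin': "finite (set_pmf (map_pmf fst ?J))" using fin by (simp only: fst_markov_law)
  note ge = max_prob_le_map_success[OF fin' B(1) snd_markov_law_subset[OF A B(2)], unfolded fst_markov_law]
  note pos = max_prob_ge(2)[OF fin]
  have "map_success ?J \<le> (1 - \<epsilon>) / 2 + T * max_prob (map_pmf fst Q)"
    using T by (intro map_success_converse[OF fin A B _ bad]) auto
  then have "map_success ?J \<le> 2 * T * max_prob (map_pmf fst Q)" using s by (simp add: field_simps)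
  then have "map_success ?J / max_prob (map_pmf fst Q) \<le> 2 * T" using pos by (simp add: divide_le_eq)
  then show "log b (map_success ?J / max_prob (map_pmf fst Q)) \<le> log b (2 * T)"
    using b pos ge T by (intro log_mono) auto
qed

text \<open>Let \<open>U\<close> be a uniformly chosen message index and \<open>X\<close> its
  codeword: then \<open>max_prob\<close> is \<open>1 / M\<close>, while decoding by the sets
  \<open>D i\<close> succeeds with probability at least 1 - \<epsilon>.\<close>

lemma leakage_ge_code:
  fixes M :: nat
  assumes b: "1 < b" and \<epsilon>: "\<epsilon> < 1" and M: "0 < M"
    and B: "finite B" "\<And>x. x \<in> A \<Longrightarrow> set_pmf (W x) \<subseteq> B"
    and x: "\<And>i. i < M \<Longrightarrow> x i \<in> A" and disj: "disjoint_family_on D {..<M}"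
    and D: "\<And>i. i < M \<Longrightarrow> 1 - \<epsilon> \<le> measure_pmf.prob (W (x i)) (D i)"
  shows "log b ((1 - \<epsilon>) * M) \<le> recoverable_leakage b \<epsilon> A W"
proof -
  define V where "V = pmf_of_set {..<M}"
  define Q where "Q = map_pmf (\<lambda>i. (i, x i)) V"
  let ?J = "markov_law Q W"
  \<comment> \<open>Disjointness makes the index unique on the union of the decoding sets; the value
    elsewhere is irrelevant.\<close>
  define d where "d = (\<lambda>y. THE i. i < M \<and> y \<in> D i)"
  have d: "d y = i" if "i < M" "y \<in> D i" for i y
    unfolding d_def using that disj by (intro the_equality) (auto simp: disjoint_family_on_def)
  have V: "set_pmf V = {..<M}" unfolding V_def using M by (intro set_pmf_of_set) auto
  have fstQ: "map_pmf fst Q = V" by (simp add: Q_def map_pmf_comp)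
  have fin: "finite (set_pmf (map_pmf fst Q))" by (simp add: fstQ V)
  have A: "set_pmf (map_pmf snd Q) \<subseteq> A" using x by (auto simp: Q_def V)
  have fin': "finite (set_pmf (map_pmf fst ?J))" using fin by (simp only: fst_markov_law)
  have "pmf V i = 1 / M" if "i < M" for i
    unfolding V_def using that by (subst pmf_of_set) auto
  then have "pmf V ` set_pmf V = {1 / M}"
    using M unfolding V by force
  then have max: "max_prob (map_pmf fst Q) = 1 / M" by (simp add: max_prob_def fstQ)
  have "1 - \<epsilon> = measure_pmf.expectation V (\<lambda>i. 1 - \<epsilon>)" by simp
  also have "\<dots> \<le> measure_pmf.expectation V (\<lambda>i. measure_pmf.prob (W (x i)) {y. i = d y})"
  proof (intro integral_mono_AE AE_pmfI)
    fix i assume "i \<in> set_pmf V"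
    then have i: "i < M" by (simp add: V)
    have "D i \<subseteq> {y. i = d y}" using d i by auto
    then show "1 - \<epsilon> \<le> measure_pmf.prob (W (x i)) {y. i = d y}"
      using D[OF i] measure_pmf.finite_measure_mono[of "D i" "{y. i = d y}" "W (x i)"] by simp
  qed (auto intro: measure_pmf.integrable_const_bound[where B = 1])
  also have "\<dots> = measure_pmf.prob ?J {(u, y). u = d y}"
    by (simp add: markov_law_prob_guess Q_def)
  also have "\<dots> \<le> map_success ?J"
    by (intro map_success_ge[OF fin' B(1)] snd_markov_law_subset[OF A B(2)])
  finally have s: "1 - \<epsilon> \<le> map_success ?J" .
  have "log b ((1 - \<epsilon>) * M) \<le> log b (map_success ?J / max_prob (map_pmf fst Q))"
    using b s \<epsilon> M by (intro log_mono) (auto simp: max)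
  also have "\<dots> \<le> recoverable_leakage b \<epsilon> A W"
    unfolding recoverable_leakage_def
    using fin A s by (intro cSUP_upper leakage_bdd_above[OF b B]) (auto simp: leakage_laws_def)
  finally show ?thesis .
qed

section \<open>Mutual information: existence and characterisation of an optimal input law\<close>

text \<open>Only \<open>0\<close> is delicate: there the product takes the value \<open>0\<close>,
  which is also its limit from the right. This gives continuity of entropy on the closed
  simplex.\<close>

lemma continuous_on_x_ln_x: "continuous_on {0..} (\<lambda>x::real. x * ln x)"
  unfolding continuous_on_eq_continuous_within
proof
  fix x :: real assume "x \<in> {0..}"
  show "continuous (at x within {0..}) (\<lambda>x. x * ln x)"
  proof (cases "x = 0")
    case True
    have "((\<lambda>x::real. x * ln x) \<longlongrightarrow> 0) (at_right 0)" by real_asymp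
    then show ?thesis by (simp add: True continuous_within at_within_Ici_at_right)
  next
    case False
    then show ?thesis by (intro continuous_intros) simp
  qed
qed

text \<open>The inequality \<open>ln z \<le> z - 1\<close> at \<open>z = q / w\<close>. Summed over
  an alphabet, it yields nonnegativity of relative entropy; single terms are also needed
  below.\<close>

lemma Gibbs_pointwise:
  fixes w q :: real
  assumes "0 \<le> w" "0 \<le> q" "w \<noteq> 0 \<Longrightarrow> q \<noteq> 0"
  shows "w - q \<le> w * ln (w / q)"
proof (cases "w = 0")
  case False
  then have w: "0 < w" and q: "0 < q" using assms by (auto simp: less_le)
  have "ln (q / w) \<le> q / w - 1" using w q by (intro ln_le_minus_one) simp
  then have "w * ln (q / w) \<le> q - w" using w by (simp add: field_simps)
  then show ?thesis using w q by (simp add: ln_div algebra_simps)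
qed (use assms in simp)

text \<open>Mutual information in nats of input \<open>p\<close> and channel
  \<open>W\<close>.\<close>

definition info :: "'x::finite pmf \<Rightarrow> ('x \<Rightarrow> 'y::finite pmf) \<Rightarrow> real" where
  "info p W = (\<Sum>x\<in>UNIV. \<Sum>y\<in>UNIV. pmf p x * pmf (W x) y * ln (pmf (W x) y / pmf (bind_pmf p W) y))"

lemma pmf_bind_finite:
  fixes p :: "'x::finite pmf"
  shows "pmf (bind_pmf p W) y = (\<Sum>x\<in>UNIV. pmf p x * pmf (W x) y)"
  unfolding pmf_bind by (subst integral_measure_pmf[of UNIV]) auto

lemma pmf_bind_pos:
  fixes p :: "'x::finite pmf"
  assumes "pmf p x * pmf (W x) y \<noteq> 0"
  shows "0 < pmf (bind_pmf p W) y"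
  unfolding pmf_bind_finite using assms by (intro sum_pos2[of _ x]) (auto simp: less_le)

text \<open>Output entropy minus conditional entropy. The first sum is linear in \<open>p\<close>,
  and the second applies \<open>x * ln x\<close> to linear functions of \<open>p\<close>, so
  continuity in \<open>p\<close> becomes visible.\<close>

lemma info_entropy_form:
  "info p W = (\<Sum>x\<in>UNIV. \<Sum>y\<in>UNIV. pmf p x * pmf (W x) y * ln (pmf (W x) y))
     - (\<Sum>y\<in>UNIV. pmf (bind_pmf p W) y * ln (pmf (bind_pmf p W) y))"
proof -
  have "info p W = (\<Sum>x\<in>UNIV. \<Sum>y\<in>UNIV. pmf p x * pmf (W x) y * ln (pmf (W x) y)
      - pmf p x * pmf (W x) y * ln (pmf (bind_pmf p W) y))"
    unfolding info_def
  proof (intro sum.cong refl)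
    fix x y
    show "pmf p x * pmf (W x) y * ln (pmf (W x) y / pmf (bind_pmf p W) y)
      = pmf p x * pmf (W x) y * ln (pmf (W x) y) - pmf p x * pmf (W x) y * ln (pmf (bind_pmf p W) y)"
    proof (cases "pmf p x * pmf (W x) y = 0")
      case False
      then show ?thesis using pmf_bind_pos[of p x W y]
        by (subst ln_divide_pos) (auto simp: algebra_simps less_le)
    qed auto
  qed
  also have "\<dots> = (\<Sum>x\<in>UNIV. \<Sum>y\<in>UNIV. pmf p x * pmf (W x) y * ln (pmf (W x) y))
     - (\<Sum>y\<in>UNIV. \<Sum>x\<in>UNIV. pmf p x * pmf (W x) y * ln (pmf (bind_pmf p W) y))"
    by (simp add: sum_subtractf) (rule sum.swap)
  finally show ?thesis by (simp add: sum_distrib_right[symmetric] pmf_bind_finite)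
qed

text \<open>A continuous function on the compact probability simplex attains its maximum; input laws
  are represented as vectors to use the topology of \<open>real ^ 'x\<close>.\<close>

lemma info_attains_max:
  fixes W :: "'x::finite \<Rightarrow> 'y::finite pmf"
  shows "\<exists>p. \<forall>p'. info p' W \<le> info p W"
proof -
  define S where "S = {v :: real ^ 'x. (\<forall>x. 0 \<le> v $ x) \<and> (\<Sum>x\<in>UNIV. v $ x) = 1}"
  define F where "F v = (\<Sum>x\<in>UNIV. \<Sum>y\<in>UNIV. v $ x * pmf (W x) y * ln (pmf (W x) y))
     - (\<Sum>y\<in>UNIV. (\<Sum>x\<in>UNIV. v $ x * pmf (W x) y) * ln (\<Sum>x\<in>UNIV. v $ x * pmf (W x) y))"
    for v :: "real ^ 'x"
  have F: "info p W = F (\<chi> x. pmf p x)" for p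
    by (simp add: F_def info_entropy_form pmf_bind_finite)
  have S: "(\<chi> x. pmf p x) \<in> S" for p :: "'x pmf"
    using sum_pmf_eq_1[of UNIV p] by (simp add: S_def)
  have S': "\<exists>p. v = (\<chi> x. pmf p x)" if "v \<in> S" for v
  proof -
    have "pmf (embed_pmf (($) v)) x = v $ x" for x
      using that by (subst pmf_embed_pmf) (auto simp: S_def nn_integral_count_space_finite sum_ennreal)
    then show ?thesis by (intro exI[of _ "embed_pmf (($) v)"]) (simp add: vec_eq_iff)
  qed
  have "closed S" unfolding S_def
    by (intro closed_Collect_conj closed_Collect_all closed_Collect_le closed_Collect_eq continuous_intros)
  moreover have "bounded S"
  proof (rule boundedI)
    fix v assume "v \<in> S"
    then have "(\<Sum>x\<in>UNIV. \<bar>v $ x\<bar>) = 1" by (simp add: S_def)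
    then show "norm v \<le> 1" using norm_le_l1_cart[of v] by simp
  qed
  ultimately have "compact S" by (simp add: compact_eq_bounded_closed)
  moreover have "S \<noteq> {}" using S by blast
  moreover have "continuous_on S F"
  proof -
    have "continuous_on S (\<lambda>v. (\<Sum>x\<in>UNIV. v $ x * pmf (W x) y) * ln (\<Sum>x\<in>UNIV. v $ x * pmf (W x) y))" for y
      by (rule continuous_on_compose2[OF continuous_on_x_ln_x])
         (auto intro!: continuous_intros sum_nonneg simp: S_def)
    then show ?thesis unfolding F_def by (intro continuous_on_diff continuous_on_sum) (auto intro!: continuous_intros)
  qed
  ultimately obtain v where "v \<in> S" "\<And>u. u \<in> S \<Longrightarrow> F u \<le> F v"
    using continuous_attains_sup[of S F] by blast
  then show ?thesis using S S' F by metis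
qed

definition mix_pmf :: "real \<Rightarrow> 'a pmf \<Rightarrow> 'a pmf \<Rightarrow> 'a pmf" where
  "mix_pmf t p q = bind_pmf (bernoulli_pmf t) (\<lambda>c. if c then p else q)"

lemma pmf_mix:
  assumes "0 \<le> t" "t \<le> 1"
  shows "pmf (mix_pmf t p q) a = t * pmf p a + (1 - t) * pmf q a"
  using assms by (simp add: mix_pmf_def pmf_bind)

lemma bind_mix: "bind_pmf (mix_pmf t p q) W = mix_pmf t (bind_pmf p W) (bind_pmf q W)"
  unfolding mix_pmf_def bind_assoc_pmf by (intro bind_pmf_cong) auto

text \<open>Relative entropy in nats. Where \<open>q\<close> vanishes but \<open>w\<close> does not,
  the term is \<open>0\<close> instead of infinity, so absolute continuity has to be tracked
  separately.\<close>

definition kl :: "'y::finite pmf \<Rightarrow> 'y pmf \<Rightarrow> real" where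
  "kl w q = (\<Sum>y\<in>UNIV. pmf w y * ln (pmf w y / pmf q y))"

lemma info_kl: "info p W = (\<Sum>x\<in>UNIV. pmf p x * kl (W x) (bind_pmf p W))"
  by (simp add: info_def kl_def sum_distrib_left mult.assoc)

text \<open>The difference of the two sides is the relative entropy of the output law
  \<open>bind_pmf p W\<close> from \<open>r\<close>, which is nonnegative.\<close>

lemma info_le_kl:
  assumes ac: "\<And>y. pmf (bind_pmf p W) y \<noteq> 0 \<Longrightarrow> pmf r y \<noteq> 0"
  shows "info p W \<le> (\<Sum>x\<in>UNIV. pmf p x * kl (W x) r)"
proof -
  let ?q = "bind_pmf p W"
  have "0 = (\<Sum>y\<in>UNIV. pmf ?q y - pmf r y)"
    by (simp add: sum_subtractf sum_pmf_eq_1)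
  also have "\<dots> \<le> (\<Sum>y\<in>UNIV. pmf ?q y * ln (pmf ?q y / pmf r y))"
    using ac by (intro sum_mono Gibbs_pointwise) auto
  also have "\<dots> = (\<Sum>x\<in>UNIV. \<Sum>y\<in>UNIV. pmf p x * pmf (W x) y * ln (pmf ?q y / pmf r y))"
    by (subst sum.swap) (simp add: sum_distrib_right[symmetric] pmf_bind_finite)
  also have "\<dots> = (\<Sum>x\<in>UNIV. \<Sum>y\<in>UNIV. pmf p x * (pmf (W x) y * ln (pmf (W x) y / pmf r y))
      - pmf p x * pmf (W x) y * ln (pmf (W x) y / pmf ?q y))"
  proof (intro sum.cong refl)
    fix x y
    show "pmf p x * pmf (W x) y * ln (pmf ?q y / pmf r y)
      = pmf p x * (pmf (W x) y * ln (pmf (W x) y / pmf r y)) - pmf p x * pmf (W x) y * ln (pmf (W x) y / pmf ?q y)"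
    proof (cases "pmf p x * pmf (W x) y = 0")
      case False
      have q: "0 < pmf ?q y" using False by (rule pmf_bind_pos)
      then have r: "0 < pmf r y" using ac[of y] by (simp add: less_le)
      have w: "0 < pmf (W x) y" using False by (auto simp: less_le)
      show ?thesis using q r w by (simp add: ln_div algebra_simps)
    qed auto
  qed
  also have "\<dots> = (\<Sum>x\<in>UNIV. pmf p x * kl (W x) r) - info p W"
    by (simp add: sum_subtractf kl_def info_def sum_distrib_left)
  finally show ?thesis by simp
qed

text \<open>Moving weight \<open>t\<close> to the input \<open>x\<close> changes the output law to
  the mixture \<open>?r\<close>. The information of the new input is an average of divergences from
  \<open>?r\<close>; its \<open>p\<close> part is at least \<open>info p W\<close> by
  \<open>info_le_kl\<close>, so optimality of \<open>p\<close> bounds the remaining part.\<close>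

lemma kl_mix_le:
  assumes max: "\<And>p'. info p' W \<le> info p W" and t: "0 < t" "t < 1"
  shows "kl (W x) (mix_pmf t (W x) (bind_pmf p W)) \<le> info p W"
proof -
  let ?p = "mix_pmf t (return_pmf x) p"
  let ?r = "mix_pmf t (W x) (bind_pmf p W)"
  have r: "bind_pmf ?p W = ?r" by (simp add: bind_mix bind_return_pmf)
  have "info p W \<ge> info ?p W" by (rule max)
  also have "info ?p W = (\<Sum>x'\<in>UNIV. (t * indicator {x} x' + (1 - t) * pmf p x') * kl (W x') ?r)"
    using t unfolding info_kl r by (simp add: pmf_mix pmf_return indicator_def) (simp add: eq_commute)
  also have "\<dots> = t * kl (W x) ?r + (1 - t) * (\<Sum>x'\<in>UNIV. pmf p x' * kl (W x') ?r)"
    by (simp add: distrib_right sum.distrib sum_distrib_left[symmetric] mult.assoc indicator_def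
        of_bool_def if_distrib[of "\<lambda>c. c * _"] cong: if_cong)
  also have "\<dots> \<ge> t * kl (W x) ?r + (1 - t) * info p W"
    using t by (intro add_left_mono mult_left_mono info_le_kl) (auto simp: pmf_mix add_nonneg_eq_0_iff)
  finally have "t * kl (W x) ?r \<le> t * info p W" by (simp add: algebra_simps)
  then show ?thesis using t by simp
qed

text \<open>The optimality condition: perturbing an optimal input law \<open>p\<close> towards the input \<open>x\<close> by \<open>t\<close>
  gives \<open>kl_mix_le\<close>, and \<open>t\<close> tends to \<open>0\<close>.\<close>

lemma optimal_output_law:
  fixes W :: "'x::finite \<Rightarrow> 'y::finite pmf"
  assumes max: "\<And>p'. info p' W \<le> info p W"
  shows "pmf (W x) y \<noteq> 0 \<Longrightarrow> pmf (bind_pmf p W) y \<noteq> 0" and "kl (W x) (bind_pmf p W) \<le> info p W"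
proof -
  let ?q = "bind_pmf p W"
  let ?r = "\<lambda>t. mix_pmf t (W x) ?q"
  define g where "g t y = pmf (W x) y * ln (pmf (W x) y / pmf (?r t) y)" for t y
  have le: "(\<Sum>y\<in>UNIV. g t y) \<le> info p W" if "0 < t" "t < 1" for t
    using kl_mix_le[OF max that, of x] by (simp add: kl_def g_def)
  have ac: "pmf ?q y \<noteq> 0" if w: "pmf (W x) y \<noteq> 0" for y
  proof
    assume 0: "pmf ?q y = 0"
    have w: "0 < pmf (W x) y" using w by (simp add: less_le)
    \<comment> \<open>If \<open>q\<close> vanished at \<open>y\<close>, then \<open>?r t\<close>
      would equal \<open>t * pmf (W x) y\<close> there, making \<open>g t y\<close> equal to
      \<open>pmf (W x) y * ln (1 / t)\<close>. This \<open>t\<close> makes it \<open>c\<close>,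
      large enough to exceed \<open>info p W\<close> even though each other term may be as low as
      \<open>-1\<close>.\<close>
    define c where "c = \<bar>info p W\<bar> + 1 + real CARD('y)"
    define t where "t = exp (- (c / pmf (W x) y))"
    have c: "0 < c" by (simp add: c_def)
    have t: "0 < t" "t < 1" using w c by (auto simp: t_def)
    have "g t y = c" using w t by (simp add: g_def pmf_mix 0 ln_div) (simp add: t_def)
    have "g t y - real CARD('y) \<le> g t y + (\<Sum>y'\<in>UNIV - {y}. - 1)"
      by (simp add: card_Diff_singleton_if)
    also have "\<dots> \<le> g t y + (\<Sum>y'\<in>UNIV - {y}. g t y')"
    proof (intro add_left_mono sum_mono)
      fix y'
      have "pmf (W x) y' - pmf (?r t) y' \<le> g t y'"
        unfolding g_def using t by (intro Gibbs_pointwise) (auto simp: pmf_mix add_nonneg_eq_0_iff)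
      then show "- 1 \<le> g t y'" using pmf_le_1[of "?r t" y'] pmf_nonneg[of "W x" y'] by linarith
    qed
    also have "\<dots> = (\<Sum>y\<in>UNIV. g t y)" by (simp add: sum.remove[of UNIV y])
    also have "\<dots> \<le> info p W" using t by (rule le)
    finally show False unfolding \<open>g t y = c\<close> by (simp add: c_def)
  qed
  then show "pmf (W x) y \<noteq> 0 \<Longrightarrow> pmf ?q y \<noteq> 0" .
  have ev: "eventually (\<lambda>t::real. 0 < t \<and> t < 1) (at_right 0)"
    by (auto simp: eventually_at_right_field intro!: exI[of _ 1])
  have "((\<lambda>t. g t y) \<longlongrightarrow> pmf (W x) y * ln (pmf (W x) y / pmf ?q y)) (at_right 0)" for y
  \<comment> \<open>Where \<open>W x\<close> charges \<open>y\<close>, so does \<open>?q\<close> by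
    \<open>ac\<close>, and the logarithm is continuous at \<open>t = 0\<close>; otherwise
    \<open>g t y\<close> is identically \<open>0\<close>.\<close>
  proof (cases "pmf (W x) y = 0")
    case False
    have "((\<lambda>t. pmf (W x) y * ln (pmf (W x) y / (t * pmf (W x) y + (1 - t) * pmf ?q y)))
      \<longlongrightarrow> pmf (W x) y * ln (pmf (W x) y / (0 * pmf (W x) y + (1 - 0) * pmf ?q y))) (at_right 0)"
      using ac[OF False] False by (intro tendsto_intros) auto
    moreover have "eventually (\<lambda>t. pmf (W x) y * ln (pmf (W x) y / (t * pmf (W x) y + (1 - t) * pmf ?q y)) = g t y) (at_right 0)"
      using ev by eventually_elim (simp add: g_def pmf_mix)
    ultimately show ?thesis using tendsto_cong by fastforce
  qed (simp add: g_def)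
  then have "((\<lambda>t. \<Sum>y\<in>UNIV. g t y) \<longlongrightarrow> kl (W x) ?q) (at_right 0)"
    unfolding kl_def by (intro tendsto_intros)
  moreover have "eventually (\<lambda>t. (\<Sum>y\<in>UNIV. g t y) \<le> info p W) (at_right 0)"
    using ev by eventually_elim (rule le, auto)
  ultimately show "kl (W x) ?q \<le> info p W"
    by (rule tendsto_upperbound) simp
qed

lemma capacity_eq_info:
  fixes W :: "'x::finite \<Rightarrow> 'y::finite pmf"
  assumes b: "1 < b" and max: "\<And>p'. info p' W \<le> info p W"
  shows "capacity b W = info p W / ln b"
proof -
  have mi: "prob_space.mutual_information (measure_pmf (io_law p W)) b
      (count_space UNIV) (count_space UNIV) fst snd = info p W / ln b" for p
    unfolding mutual_information_io_law[OF b] info_def sum_divide_distrib UNIV_Times_UNIV[symmetric]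
      sum.cartesian_product by (simp add: log_def case_prod_unfold)
  show ?thesis unfolding capacity_def mi
    using b max by (intro cSup_eq_maximum) (auto intro!: divide_right_mono)
qed

section \<open>Feinstein's lemma and one-shot achievability\<close>

text \<open>Take a largest code whose decoding sets lie in the high-likelihood regions
  \<open>G\<close>. As it cannot be extended, the union \<open>U\<close> of its decoding sets
  captures nearly all of each \<open>G a\<close> beyond 1 - \<epsilon>; but each decoding set has
  output probability at most \<open>1 / T\<close>, so many are needed.\<close>

lemma Feinstein:
  fixes T :: real
  assumes p: "finite (set_pmf p)" and B: "finite B" "\<And>x. x \<in> set_pmf p \<Longrightarrow> set_pmf (W x) \<subseteq> B"
    and T: "0 < T" and \<epsilon>: "\<epsilon> < 1"
  shows "\<exists>(M::nat) x D. (\<forall>i::nat. i < M \<longrightarrow> x i \<in> set_pmf p \<and> 1 - \<epsilon> \<le> measure_pmf.prob (W (x i)) (D i)) \<and>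
    disjoint_family_on D {..<M} \<and>
    T * (measure_pmf.prob (io_law p W) {(x, y). T * pmf (bind_pmf p W) y < pmf (W x) y} - (1 - \<epsilon>)) \<le> M"
proof -
  define q where "q = bind_pmf p W"
  define G where "G x = {y. T * pmf q y < pmf (W x) y}" for x
  define code where "code M x D \<longleftrightarrow>
      (\<forall>i::nat. i < M \<longrightarrow> x i \<in> set_pmf p \<and> D i \<subseteq> G (x i) \<inter> B \<and> 1 - \<epsilon> \<le> measure_pmf.prob (W (x i)) (D i)) \<and>
      disjoint_family_on D {..<M}" for M :: nat and x D
  \<comment> \<open>Since \<epsilon> < 1, decoding sets are nonempty, and they are disjoint subsets
    of the finite set \<open>B\<close>; so code sizes are bounded and a largest code exists.\<close>
  have bound: "M \<le> card B" if "code M x D" for M x D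
  proof -
    have D: "D i \<subseteq> B" "D i \<noteq> {}" if "i < M" for i
      using \<open>code M x D\<close> that \<epsilon> unfolding code_def by (blast, force)
    have fin: "finite (D i)" if "i < M" for i using D[OF that] B(1) by (simp add: finite_subset)
    have "M = (\<Sum>i<M. 1)" by simp
    also have "\<dots> \<le> (\<Sum>i<M. card (D i))"
      using D fin by (intro sum_mono) (simp add: Suc_le_eq card_gt_0_iff)
    also have "\<dots> = card (\<Union>i<M. D i)"
      using that fin by (intro card_UN_disjoint'[symmetric]) (auto simp: code_def)
    also have "\<dots> \<le> card B" using D B by (intro card_mono) auto
    finally show ?thesis .
  qed
  have "\<exists>x D. code 0 x D" by (simp add: code_def disjoint_family_on_def)
  then have "\<exists>M. (\<exists>x D. code M x D) \<and> (\<forall>N. (\<exists>x D. code N x D) \<longrightarrow> N \<le> M)"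
    by (rule Nat.ex_has_greatest_nat[where b = "card B"]) (use bound in blast)
  then obtain M x D where code: "code M x D" and maximal: "\<And>N x' D'. code N x' D' \<Longrightarrow> N \<le> M"
    by blast
  define U where "U = (\<Union>i<M. D i)"
  have max: "measure_pmf.prob (W a) (G a) \<le> 1 - \<epsilon> + measure_pmf.prob (W a) U"
    if a: "a \<in> set_pmf p" for a
  proof -
    \<comment> \<open>If \<open>a\<close> could still be decoded with error at most \<epsilon> from
      what \<open>U\<close> leaves of \<open>G a\<close>, it would be one more codeword.\<close>
    have "code (Suc M) (x(M := a)) (D(M := G a \<inter> B - U))"
      if "1 - \<epsilon> \<le> measure_pmf.prob (W a) (G a \<inter> B - U)"
    proof -
      let ?D = "D(M := G a \<inter> B - U)"
      have "disjoint_family_on ?D {..<M}"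
        using code unfolding code_def disjoint_family_on_def by simp
      moreover have "?D M \<inter> (\<Union>i<M. ?D i) = {}" by (auto simp: U_def)
      ultimately have "disjoint_family_on ?D {..<Suc M}"
        unfolding lessThan_Suc by (subst disjoint_family_on_insert) simp_all
      then show ?thesis using code that a by (simp add: code_def less_Suc_eq) blast
    qed
    then have "measure_pmf.prob (W a) (G a \<inter> B - U) < 1 - \<epsilon>"
      using maximal by (meson not_less not_less_eq_eq order_refl)
    moreover have "measure_pmf.prob (W a) (G a) = measure_pmf.prob (W a) (G a \<inter> set_pmf (W a))"
      by (simp add: measure_Int_set_pmf)
    moreover have "\<dots> \<le> measure_pmf.prob (W a) ((G a \<inter> B - U) \<union> U)"
      using B(2)[OF a] by (intro measure_pmf.finite_measure_mono) auto
    moreover have "\<dots> \<le> measure_pmf.prob (W a) (G a \<inter> B - U) + measure_pmf.prob (W a) U"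
      by (intro measure_Un_le) auto
    ultimately show ?thesis by linarith
  qed
  have "measure_pmf.prob (io_law p W) {(x, y). T * pmf q y < pmf (W x) y}
      = measure_pmf.expectation p (\<lambda>x. measure_pmf.prob (W x) (G x))"
    by (simp add: io_law_def measure_bind_pmf_integral vimage_def G_def)
  also have "\<dots> \<le> measure_pmf.expectation p (\<lambda>x. 1 - \<epsilon> + measure_pmf.prob (W x) U)"
    using p by (intro integral_mono_AE AE_pmfI max integrable_measure_pmf_finite) auto
  also have "\<dots> = 1 - \<epsilon> + measure_pmf.prob q U"
    using p by (simp add: q_def measure_bind_pmf_integral integrable_measure_pmf_finite)
  also have "measure_pmf.prob q U \<le> (\<Sum>i<M. measure_pmf.prob q (D i))"
    unfolding U_def by (intro measure_pmf.finite_measure_subadditive_finite) auto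
  also have "\<dots> \<le> (\<Sum>i<M. 1 / T)"
  proof (rule sum_mono)
    fix i assume "i \<in> {..<M}"
    then have i: "D i \<subseteq> G (x i) \<inter> B" using code by (auto simp: code_def)
    then have fin: "finite (D i)" using B by (auto intro: finite_subset)
    \<comment> \<open>On \<open>G (x i)\<close> the mass of \<open>W (x i)\<close> exceeds
      \<open>T\<close> times that of \<open>q\<close>, and \<open>W (x i)\<close> has total mass
      1.\<close>
    have "T * measure_pmf.prob q (D i) = (\<Sum>y\<in>D i. T * pmf q y)"
      using fin by (simp add: measure_measure_pmf_finite sum_distrib_left)
    also have "\<dots> \<le> (\<Sum>y\<in>D i. pmf (W (x i)) y)"
      using i by (intro sum_mono) (auto simp: G_def intro: less_imp_le)
    also have "\<dots> = measure_pmf.prob (W (x i)) (D i)"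
      using fin by (simp add: measure_measure_pmf_finite)
    also have "\<dots> \<le> 1" by simp
    finally show "measure_pmf.prob q (D i) \<le> 1 / T" using T by (simp add: field_simps)
  qed
  finally have "measure_pmf.prob (io_law p W) {(x, y). T * pmf q y < pmf (W x) y} - (1 - \<epsilon>) \<le> M / T"
    by simp
  then have "T * (measure_pmf.prob (io_law p W) {(x, y). T * pmf q y < pmf (W x) y} - (1 - \<epsilon>)) \<le> M"
    using T by (simp add: field_simps)
  then show ?thesis using code unfolding code_def q_def by blast
qed

lemma leakage_ge:
  assumes b: "1 < b" and \<epsilon>: "\<epsilon> < 1" and A: "finite A" and p: "set_pmf p \<subseteq> A"
    and B: "finite B" "\<And>x. x \<in> A \<Longrightarrow> set_pmf (W x) \<subseteq> B" and T: "0 < T"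
    and good: "1 - \<epsilon> < measure_pmf.prob (io_law p W) {(x, y). T * pmf (bind_pmf p W) y < pmf (W x) y}"
      (is "_ < ?g")
  shows "log b ((1 - \<epsilon>) * (T * (?g - (1 - \<epsilon>)))) \<le> recoverable_leakage b \<epsilon> A W"
proof -
  obtain M :: nat and x D where code: "\<forall>i::nat. i < M \<longrightarrow> x i \<in> set_pmf p \<and> 1 - \<epsilon> \<le> measure_pmf.prob (W (x i)) (D i)"
    "disjoint_family_on D {..<M}" and M: "T * (?g - (1 - \<epsilon>)) \<le> M"
    using Feinstein[OF finite_subset[OF p A] B(1) _ T \<epsilon>, of W] B(2) p by blast
  \<comment> \<open>The strict inequality in \<open>good\<close> ensures that the code is
    nonempty.\<close>
  have pos: "0 < T * (?g - (1 - \<epsilon>))" using T good by simp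
  then have "0 < M" using M by (cases M) auto
  have "0 < (1 - \<epsilon>) * (T * (?g - (1 - \<epsilon>)))" by (rule mult_pos_pos[OF _ pos]) (use \<epsilon> in simp)
  then have "log b ((1 - \<epsilon>) * (T * (?g - (1 - \<epsilon>)))) \<le> log b ((1 - \<epsilon>) * M)"
    using b \<epsilon> M by (intro log_mono mult_left_mono) auto
  also have "\<dots> \<le> recoverable_leakage b \<epsilon> A W"
    using code p by (intro leakage_ge_code[OF b \<epsilon> \<open>0 < M\<close> B, where x = x and D = D]) auto
  finally show ?thesis .
qed

section \<open>Words, memoryless channels and concentration of the likelihood ratio\<close>

lemma finite_words: "finite (words n :: (nat \<Rightarrow> 'x::finite) set)"
  by (simp add: words_def finite_PiE)

lemma words_iff: "xs \<in> words n \<longleftrightarrow> (\<forall>i. i \<notin> {..<n} \<longrightarrow> xs i = undefined)"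
  by (auto simp: words_def PiE_def extensional_def)

lemma set_Pi_pmf_words: "set_pmf (Pi_pmf {..<n} undefined P) \<subseteq> words n"
  using set_Pi_pmf_subset[of "{..<n}" undefined P] by (auto simp: words_iff)

lemma set_product_channel: "set_pmf (product_channel n W xs) \<subseteq> words n"
  unfolding product_channel_def by (rule set_Pi_pmf_words)

lemma pmf_Pi_words:
  "pmf (Pi_pmf {..<n} undefined P) ys = (if ys \<in> words n then \<Prod>i<n. pmf (P i) (ys i) else 0)"
  unfolding words_iff by (rule pmf_Pi) simp

text \<open>Positivity of all letter probabilities allows taking logarithms, which turns the ratio
  of products into a sum to which Hoeffding's inequality applies.\<close>

lemma likelihood_ratio_words:
  assumes ys: "ys \<in> words n" and pos: "\<And>i. i < n \<Longrightarrow> 0 < pmf (W (xs i)) (ys i)"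
    "\<And>i. i < n \<Longrightarrow> 0 < pmf q (ys i)"
  shows "exp t * pmf (Pi_pmf {..<n} undefined (\<lambda>_. q)) ys < pmf (product_channel n W xs) ys
    \<longleftrightarrow> t < (\<Sum>i<n. ln (pmf (W (xs i)) (ys i) / pmf q (ys i)))" (is "_ \<longleftrightarrow> t < ?s")
proof -
  let ?q = "pmf (Pi_pmf {..<n} undefined (\<lambda>_. q)) ys"
  have q: "?q = (\<Prod>i<n. pmf q (ys i))" using ys by (simp add: pmf_Pi_words)
  then have "0 < ?q" using pos by (auto intro: prod_pos)
  have "pmf (product_channel n W xs) ys = (\<Prod>i<n. exp (ln (pmf (W (xs i)) (ys i) / pmf q (ys i))) * pmf q (ys i))"
    unfolding pmf_product_channel[OF ys]
  proof (rule prod.cong)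
    fix i assume "i \<in> {..<n}"
    then show "pmf (W (xs i)) (ys i) = exp (ln (pmf (W (xs i)) (ys i) / pmf q (ys i))) * pmf q (ys i)"
      using pos[of i] by (simp add: exp_ln)
  qed simp
  also have "\<dots> = exp ?s * ?q" by (simp add: q prod.distrib exp_sum)
  finally show ?thesis using \<open>0 < ?q\<close> by simp
qed

text \<open>Supplies the constant \<open>K\<close> for Hoeffding's inequality; the added
  \<open>1\<close> in the witness keeps it positive when \<open>f\<close> is zero.\<close>

lemma finite_types_bounded:
  fixes f :: "'x::finite \<Rightarrow> 'y::finite \<Rightarrow> real"
  shows "\<exists>K>0. \<forall>x y. \<bar>f x y\<bar> \<le> K"
proof (intro exI conjI allI)
  let ?S = "\<Sum>z\<in>UNIV. \<bar>f (fst z) (snd z)\<bar>"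
  show "0 < 1 + ?S" by (intro add_pos_nonneg sum_nonneg) auto
  fix x y
  show "\<bar>f x y\<bar> \<le> 1 + ?S"
    using member_le_sum[of "(x, y)" UNIV "\<lambda>z. \<bar>f (fst z) (snd z)\<bar>"] by simp
qed

text \<open>Uniform over input words: given \<open>xs\<close>, the mean log-likelihood ratio is a
  sum of \<open>n\<close> divergences, each at most \<open>C\<close>, so exceeding
  \<open>n * (C + \<delta>)\<close> is a deviation by at least \<open>n * \<delta>\<close>.\<close>

lemma product_channel_likelihood_upper:
  fixes W :: "'x \<Rightarrow> 'y::finite pmf"
  assumes n: "0 < n" and K: "0 < K" "\<And>x y. \<bar>ln (pmf (W x) y / pmf q y)\<bar> \<le> K" and \<delta>: "0 \<le> \<delta>"
    and ac: "\<And>x y. pmf (W x) y \<noteq> 0 \<Longrightarrow> pmf q y \<noteq> 0" and C: "\<And>x. kl (W x) q \<le> C"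
  shows "measure_pmf.prob (product_channel n W xs)
    {ys. exp (real n * (C + \<delta>)) * pmf (Pi_pmf {..<n} undefined (\<lambda>_. q)) ys < pmf (product_channel n W xs) ys}
    \<le> exp (- (real n * \<delta>\<^sup>2 / (2 * K\<^sup>2)))"
proof -
  define f where "f i y = ln (pmf (W (xs i)) y / pmf q y)" for i y
  let ?P = "product_channel n W xs"
  let ?S = "{ys. exp (real n * (C + \<delta>)) * pmf (Pi_pmf {..<n} undefined (\<lambda>_. q)) ys < pmf ?P ys}"
  let ?E = "\<lambda>i. measure_pmf.expectation (W (xs i)) (f i)"
  have E: "?E i = kl (W (xs i)) q" for i
    unfolding kl_def f_def by (subst integral_measure_pmf[of UNIV]) auto
  \<comment> \<open>Restricting to the support makes every letter probability positive, as
    \<open>likelihood_ratio_words\<close> requires.\<close>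
  have "measure_pmf.prob ?P ?S = measure_pmf.prob ?P (?S \<inter> set_pmf ?P)"
    by (simp add: measure_Int_set_pmf)
  also have "\<dots> \<le> measure_pmf.prob ?P {ys. (\<Sum>i<n. ?E i) + real (card {..<n}) * \<delta> \<le> (\<Sum>i<n. f i (ys i))}"
  proof (intro measure_pmf.finite_measure_mono subsetI)
    fix ys assume ys: "ys \<in> ?S \<inter> set_pmf ?P"
    then have w: "ys \<in> words n" using set_product_channel by fast
    have "pmf ?P ys \<noteq> 0" using ys by (simp add: set_pmf_iff)
    then have W: "pmf (W (xs i)) (ys i) \<noteq> 0" if "i < n" for i
      using that by (simp add: pmf_product_channel[OF w])
    have "real n * (C + \<delta>) < (\<Sum>i<n. f i (ys i))"
      unfolding f_def using W ac ys
      by (subst likelihood_ratio_words[OF w, symmetric]) (auto simp: less_le)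
    moreover have "(\<Sum>i<n. ?E i) \<le> (\<Sum>i<n. C)"
      unfolding E by (intro sum_mono C)
    ultimately show "ys \<in> {ys. (\<Sum>i<n. ?E i) + real (card {..<n}) * \<delta> \<le> (\<Sum>i<n. f i (ys i))}"
      by (simp add: distrib_left)
  qed simp
  also have "\<dots> \<le> exp (- (real (card {..<n}) * \<delta>\<^sup>2 / (2 * K\<^sup>2)))"
    unfolding product_channel_def using n K \<delta>
    by (intro Pi_pmf_Hoeffding) (auto simp: f_def)
  finally show ?thesis by simp
qed

text \<open>A word of independent pairs is the same as a pair of words; the default pair
  \<open>(undefined, undefined)\<close> projects to the defaults of both. Hoeffding's inequality can
  then be applied to the pairs.\<close>

lemma io_law_product:
  "io_law (Pi_pmf {..<n} undefined (\<lambda>_. p)) (product_channel n W)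
    = map_pmf (\<lambda>h. (fst \<circ> h, snd \<circ> h)) (Pi_pmf {..<n} (undefined, undefined) (\<lambda>_. io_law p W))"
proof (rule pmf_eqI)
  fix z :: "(nat \<Rightarrow> 'a) \<times> (nat \<Rightarrow> 'b)"
  obtain xs ys where z: "z = (xs, ys)" by force
  define h where "h i = (xs i, ys i)" for i
  have inj: "inj (\<lambda>h :: nat \<Rightarrow> 'a \<times> 'b. (fst \<circ> h, snd \<circ> h))"
    by (rule injI) (auto simp: fun_eq_iff prod_eq_iff)
  have zh: "z = (fst \<circ> h, snd \<circ> h)" by (simp add: z h_def fun_eq_iff)
  have "pmf (map_pmf (\<lambda>h. (fst \<circ> h, snd \<circ> h)) (Pi_pmf {..<n} (undefined, undefined) (\<lambda>_. io_law p W))) z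
      = pmf (Pi_pmf {..<n} (undefined, undefined) (\<lambda>_. io_law p W)) h"
    unfolding zh by (rule pmf_map_inj'[OF inj])
  also have "\<dots> = (if xs \<in> words n \<and> ys \<in> words n then \<Prod>i<n. pmf p (xs i) * pmf (W (xs i)) (ys i) else 0)"
    by (subst pmf_Pi) (auto simp: h_def words_iff pmf_io_law)
  also have "\<dots> = pmf (io_law (Pi_pmf {..<n} undefined (\<lambda>_. p)) (product_channel n W)) z"
    by (simp add: z pmf_io_law product_channel_def pmf_Pi_words prod.distrib)
  finally show "pmf (io_law (Pi_pmf {..<n} undefined (\<lambda>_. p)) (product_channel n W)) z
    = pmf (map_pmf (\<lambda>h. (fst \<circ> h, snd \<circ> h)) (Pi_pmf {..<n} (undefined, undefined) (\<lambda>_. io_law p W))) z"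
    by simp
qed

lemma bind_product:
  "bind_pmf (Pi_pmf {..<n} undefined (\<lambda>_. p)) (product_channel n W)
    = Pi_pmf {..<n} undefined (\<lambda>_. bind_pmf p W)"
  by (simp add: product_channel_def[abs_def] Pi_pmf_bind[where d' = undefined])

text \<open>For i.i.d. inputs from \<open>p\<close>, the per-letter log-likelihood ratio has mean
  \<open>info p W\<close>, so falling to \<open>n * (info p W - \<delta>)\<close> or below is a
  large deviation.\<close>

lemma product_channel_likelihood_lower:
  fixes W :: "'x::finite \<Rightarrow> 'y::finite pmf"
  assumes n: "0 < n" and K: "0 < K" "\<And>x y. \<bar>ln (pmf (W x) y / pmf (bind_pmf p W) y)\<bar> \<le> K" and \<delta>: "0 \<le> \<delta>"
  shows "1 - exp (- (real n * \<delta>\<^sup>2 / (2 * K\<^sup>2)))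
    \<le> measure_pmf.prob (io_law (Pi_pmf {..<n} undefined (\<lambda>_. p)) (product_channel n W))
        {(xs, ys). exp (real n * (info p W - \<delta>)) * pmf (bind_pmf (Pi_pmf {..<n} undefined (\<lambda>_. p)) (product_channel n W)) ys
          < pmf (product_channel n W xs) ys}" (is "_ \<le> measure_pmf.prob _ ?G")
proof -
  \<comment> \<open>The sign is reversed so that the upper-tail bound of
    \<open>Pi_pmf_Hoeffding\<close> controls the lower tail.\<close>
  define f :: "nat \<Rightarrow> 'x \<times> 'y \<Rightarrow> real"
    where "f = (\<lambda>_ (x, y). - ln (pmf (W x) y / pmf (bind_pmf p W) y))"
  let ?J = "Pi_pmf {..<n} (undefined, undefined) (\<lambda>_. io_law p W)"
  let ?E = "\<lambda>i. measure_pmf.expectation (io_law p W) (f i)"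
  let ?S = "{h. (\<Sum>i<n. ?E i) + real (card {..<n}) * \<delta> \<le> (\<Sum>i<n. f i (h i))}"
  have E: "?E i = - info p W" for i
    unfolding info_def sum.cartesian_product UNIV_Times_UNIV f_def
    by (subst integral_measure_pmf[of UNIV]) (auto simp: pmf_io_law case_prod_unfold sum_negf intro: sum.cong)
  have "measure_pmf.prob ?J ?S \<le> exp (- (real (card {..<n}) * \<delta>\<^sup>2 / (2 * K\<^sup>2)))"
    using n K \<delta> by (intro Pi_pmf_Hoeffding) (auto simp: f_def split: prod.split)
  then have "1 - exp (- (real n * \<delta>\<^sup>2 / (2 * K\<^sup>2))) \<le> 1 - measure_pmf.prob ?J ?S" by simp
  also have "\<dots> = measure_pmf.prob ?J (- ?S)"
    using measure_pmf.prob_compl[of ?S ?J] by (simp add: Compl_eq_Diff_UNIV)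
  also have "\<dots> = measure_pmf.prob ?J (- ?S \<inter> set_pmf ?J)"
    by (simp only: measure_Int_set_pmf)
  also have "\<dots> \<le> measure_pmf.prob ?J ((\<lambda>h. (fst \<circ> h, snd \<circ> h)) -` ?G)"
  proof (intro measure_pmf.finite_measure_mono subsetI)
    fix h assume h: "h \<in> - ?S \<inter> set_pmf ?J"
    have "pmf ?J h \<noteq> 0" using h by (simp add: set_pmf_iff)
    then have w: "fst \<circ> h \<in> words n" "snd \<circ> h \<in> words n"
      and prod: "(\<Prod>i<n. pmf (io_law p W) (h i)) \<noteq> 0"
      by (auto simp: pmf_Pi words_iff split: if_splits)
    then have nz: "pmf p (fst (h i)) * pmf (W (fst (h i))) (snd (h i)) \<noteq> 0" if "i < n" for i
      using that pmf_io_law[of p W "fst (h i)" "snd (h i)"] by auto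
    have pos: "0 < pmf (W (fst (h i))) (snd (h i))" "0 < pmf (bind_pmf p W) (snd (h i))" if "i < n" for i
      using nz[OF that] pmf_bind_pos[of p "fst (h i)" W "snd (h i)"] by (auto simp: less_le)
    have "real n * (info p W - \<delta>) < (\<Sum>i<n. ln (pmf (W (fst (h i))) (snd (h i)) / pmf (bind_pmf p W) (snd (h i))))"
      using h unfolding Int_iff Compl_iff mem_Collect_eq E
      by (simp add: f_def case_prod_unfold sum_negf algebra_simps)
    then have "exp (real n * (info p W - \<delta>)) * pmf (Pi_pmf {..<n} undefined (\<lambda>_. bind_pmf p W)) (snd \<circ> h)
        < pmf (product_channel n W (fst \<circ> h)) (snd \<circ> h)"
      using pos by (subst likelihood_ratio_words[OF w(2)]) auto
    then show "h \<in> (\<lambda>h. (fst \<circ> h, snd \<circ> h)) -` ?G" by (simp add: bind_product)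
  qed simp
  also have "\<dots> = measure_pmf.prob (io_law (Pi_pmf {..<n} undefined (\<lambda>_. p)) (product_channel n W)) ?G"
    by (simp only: io_law_product measure_map_pmf)
  finally show ?thesis .
qed

section \<open>The asymptotic leakage rate\<close>

lemma leakage_rate_limit:
  fixes W :: "'x::finite \<Rightarrow> 'y::finite pmf"
  assumes b: "1 < b" and \<epsilon>: "0 < \<epsilon>" "\<epsilon> < 1"
  shows "(\<lambda>n. 1 / real n * recoverable_leakage b \<epsilon> (words n) (product_channel n W)) \<longlonglongrightarrow> capacity b W"
proof (rule tendstoI)
  fix e :: real assume e: "0 < e"
  let ?L = "\<lambda>n. recoverable_leakage b \<epsilon> (words n) (product_channel n W)"
  obtain p where max: "\<And>p'. info p' W \<le> info p W" using info_attains_max[of W] by blast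
  define C where "C = info p W"
  define q where "q = bind_pmf p W"
  have cap: "capacity b W = C / ln b" unfolding C_def by (rule capacity_eq_info[OF b max])
  have ac: "pmf (W x) y \<noteq> 0 \<Longrightarrow> pmf q y \<noteq> 0" and kl: "kl (W x) q \<le> C" for x y
    unfolding q_def C_def using optimal_output_law[OF max] by blast+
  obtain K where K: "0 < K" "\<And>x y. \<bar>ln (pmf (W x) y / pmf q y)\<bar> \<le> K"
    using finite_types_bounded[of "\<lambda>x y. ln (pmf (W x) y / pmf q y)"] by blast
  have lnb: "0 < ln b" using b by simp
  \<comment> \<open>In base \<open>b\<close>, the tolerance \<open>n * e\<close> is worth
    \<open>2 * n * \<delta>\<close> nats: one \<open>n * \<delta>\<close> is the slack in the
    thresholds, the other absorbs the constants \<open>ln 2\<close> and \<open>ln c\<close>.\<close>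
  define \<delta> where "\<delta> = e * ln b / 2"
  have \<delta>: "0 < \<delta>" using e lnb by (simp add: \<delta>_def)
  define r where "r = \<delta>\<^sup>2 / (2 * K\<^sup>2)"
  have "0 < r" using \<delta> K by (simp add: r_def)
  then have lim: "(\<lambda>n. exp (- (real n * r))) \<longlonglongrightarrow> 0" by real_asymp
  \<comment> \<open>Here 1 - \<epsilon> is the prefactor in \<open>leakage_ge\<close>, and
    \<epsilon>/2 is the margin by which the good event exceeds 1 - \<epsilon>.\<close>
  define c where "c = (1 - \<epsilon>) * \<epsilon> / 2"
  have c: "0 < c" using \<epsilon> by (simp add: c_def)
  \<comment> \<open>The first bound on the Hoeffding tail serves the converse, the second
    achievability.\<close>
  have ev: "\<forall>\<^sub>F n in sequentially. exp (- (real n * r)) < min ((1 - \<epsilon>) / 2) (\<epsilon> / 2)"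
    using \<epsilon> by (intro order_tendstoD(2)[OF lim]) auto
  have ev2: "\<forall>\<^sub>F n in sequentially. \<bar>a\<bar> / real n < \<delta>" for a
    by (intro order_tendstoD(2)[OF _ \<delta>]) real_asymp
  show "\<forall>\<^sub>F n in sequentially. dist (1 / real n * ?L n) (capacity b W) < e"
    using ev ev2[of "ln 2"] ev2[of "ln c"] eventually_gt_at_top[of 0]
  proof eventually_elim
    case (elim n)
    note n = \<open>0 < n\<close>
    have n2: "ln 2 < n * \<delta>" "- ln c < n * \<delta>"
      using elim(2,3) n by (auto simp: field_simps)
    have bad: "exp (- (real n * \<delta>\<^sup>2 / (2 * K\<^sup>2))) \<le> (1 - \<epsilon>) / 2" "exp (- (real n * \<delta>\<^sup>2 / (2 * K\<^sup>2))) \<le> \<epsilon> / 2"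
      using elim(1) by (auto simp: r_def)
    have "?L n \<le> log b (2 * exp (real n * (C + \<delta>)))"
    proof (rule leakage_le[OF b _ _ finite_words set_product_channel])
      show "measure_pmf.prob (product_channel n W xs)
         {ys. exp (real n * (C + \<delta>)) * pmf (Pi_pmf {..<n} undefined (\<lambda>_. q)) ys < pmf (product_channel n W xs) ys}
         \<le> (1 - \<epsilon>) / 2" for xs
        by (rule order_trans[OF product_channel_likelihood_upper bad(1)]) (use n K \<delta> ac kl in auto)
    qed (use \<epsilon> in \<open>auto simp: words_def PiE_eq_empty_iff\<close>)
    also have "\<dots> = (ln 2 + real n * (C + \<delta>)) / ln b" by (simp add: log_def ln_mult)
    also have "\<dots> < real n * (C / ln b + e)"
      using n2 lnb by (simp add: \<delta>_def field_simps)
    finally have upper: "?L n < real n * (C / ln b + e)" .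
    let ?p = "Pi_pmf {..<n} undefined (\<lambda>_. p)"
    define T where "T = exp (real n * (C - \<delta>))"
    define g where "g = measure_pmf.prob (io_law ?p (product_channel n W))
      {(xs, ys). T * pmf (bind_pmf ?p (product_channel n W)) ys < pmf (product_channel n W xs) ys}"
    have g: "1 - \<epsilon> / 2 \<le> g"
      using product_channel_likelihood_lower[OF n K[unfolded q_def], of \<delta>] \<delta> bad(2)
      unfolding g_def T_def C_def by linarith
    have T: "0 < T" by (simp add: T_def)
    have "real n * (C / ln b - e) = (real n * C - 2 * (real n * \<delta>)) / ln b"
      using lnb by (simp add: \<delta>_def field_simps)
    also have "\<dots> < (ln c + real n * (C - \<delta>)) / ln b"
      using n2 lnb by (intro divide_strict_right_mono) (simp_all add: algebra_simps)
    also have "\<dots> = log b (c * T)" using c by (simp add: log_def T_def ln_mult)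
    also have "\<dots> \<le> log b ((1 - \<epsilon>) * (T * (g - (1 - \<epsilon>))))"
    proof (rule log_mono)
      have "(1 - \<epsilon>) * (T * (\<epsilon> / 2)) \<le> (1 - \<epsilon>) * (T * (g - (1 - \<epsilon>)))"
        using g \<epsilon> T by (intro mult_left_mono) auto
      then show "c * T \<le> (1 - \<epsilon>) * (T * (g - (1 - \<epsilon>)))" by (simp add: c_def algebra_simps)
    qed (use b c T in auto)
    also have "\<dots> \<le> ?L n"
      unfolding g_def using g \<epsilon>
      by (intro leakage_ge[OF b \<epsilon>(2) finite_words set_Pi_pmf_words finite_words set_product_channel T])
         (simp add: g_def)
    finally have lower: "real n * (C / ln b - e) < ?L n" .
    show ?case
      using upper lower n by (simp add: dist_real_def cap abs_less_iff field_simps)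
  qed
qed

theorem theorem12:
  fixes P :: "('x::finite \<times> 'y::finite) pmf" and W :: "'x \<Rightarrow> 'y pmf" and b :: real
  assumes "1 < b" and "is_channel_of P W"
  shows "\<exists>g :: real \<Rightarrow> real.
    (\<forall>\<^sub>F \<epsilon> in at_right 0.
       (\<lambda>n. 1 / real n * recoverable_leakage b \<epsilon> (words n) (product_channel n W))
         \<longlonglongrightarrow> g \<epsilon>) \<and>
    (g \<longlongrightarrow> capacity b W) (at_right 0)"
\<comment> \<open>The inner limit is already the capacity for every \<epsilon> strictly between 0
  and 1, so a constant \<open>g\<close> suffices and the outer limit is immediate.\<close>
proof (intro exI[of _ "\<lambda>_. capacity b W"] conjI tendsto_const)
  show "\<forall>\<^sub>F \<epsilon> in at_right 0.
      (\<lambda>n. 1 / real n * recoverable_leakage b \<epsilon> (words n) (product_channel n W)) \<longlonglongrightarrow> capacity b W"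
    unfolding eventually_at_right_field
    using leakage_rate_limit[OF \<open>1 < b\<close>] zero_less_one by blast
qed

end
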